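(* Let $n\ge 1$ and let $p<\alpha<\beta<q$ be four arbitrary finite real numbers satisfying $p+q=\alpha+\beta$. Then there is a continuous bounded radial function $\varphi(x)=\varphi(|x|)$, $x\in\mathbb{R}^n$, such that its average integral $H(\tau)$ and the convolution solution $u(x,t)$ of the heat equation with initial data $\varphi$ satisfy $$\liminf_{\tau\to\infty}H(\tau)=p<\liminf_{t\to\infty}u(0,t)=\alpha<\limsup_{t\to\infty}u(0,t)=\beta<\limsup_{\tau\to\infty}H(\tau)=q.$$ More precisely, one can choose $$\varphi(\tau)=\frac{q-p}{2}\sin\left(m\log(\tau+1)\right)+\frac{q-p}{2}\,\frac{m\tau}{n(\tau+1)}\cos\left(m\log(\tau+1)\right)+\frac{q+p}{2},\qquad \tau\in[0,\infty),$$ where $m\in(0,\infty)$ is a number (which exists) satisfying $$\left(\frac{2\omega(n)}{\pi^{n/2}}\int_0^\infty e^{-z^2}z^{n+1}\cos(m\log z)\,dz\right)^2+\left(\frac{2\omega(n)}{\pi^{n/2}}\int_0^\infty e^{-z^2}z^{n+1}\sin(m\log z)\,dz\right)^2=\left(\frac{\beta-\alpha}{q-p}\right)^2\in(0,1).$$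
   Context: $\omega(n)=|B(0,1)|$ is the volume of the unit ball in $\mathbb{R}^n$. For a continuous bounded $\varphi:\mathbb{R}^n\to\mathbb{R}$, the average integral is $H(\tau)=\frac{1}{\omega(n)\tau^n}\int_{B(0,\tau)}\varphi(y)\,dy$ for $\tau\in(0,\infty)$, $H(0)=\varphi(0)$, where $B(0,\tau)$ is the open ball of radius $\tau$ centered at the origin. The convolution solution of $u_t=\Delta u$ on $\mathbb{R}^n\times(0,\infty)$, $u(x,0)=\varphi(x)$, is $u(x,t)=\frac{1}{(4\pi t)^{n/2}}\int_{\mathbb{R}^n}e^{-|x-y|^2/(4t)}\varphi(y)\,dy$. A radial function is written $\varphi(x)=\varphi(\tau)$ with $\tau=|x|\in[0,\infty)$. *)

theory Defs
  imports "HOL-Analysis.Analysis" "HOL-Library.Extended_Real"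
begin

definition ball_volume :: "'n::finite itself \<Rightarrow> real" where
  "ball_volume _ = measure lborel (ball (0 :: real ^ 'n) 1)"

definition radial :: "(real ^ 'n::finite \<Rightarrow> real) \<Rightarrow> bool" where
  "radial \<phi> \<longleftrightarrow> (\<exists>f :: real \<Rightarrow> real. \<forall>x. \<phi> x = f (norm x))"

definition ball_average :: "(real ^ 'n::finite \<Rightarrow> real) \<Rightarrow> real \<Rightarrow> real" where
  "ball_average \<phi> \<tau> =
     (if \<tau> = 0 then \<phi> 0
      else (LINT y:ball 0 \<tau>|lborel. \<phi> y) / (ball_volume TYPE('n) * \<tau> ^ CARD('n)))"

text \<open>Only the values for \<open>t > 0\<close> are meaningful.\<close>

definition heat_solution :: "(real ^ 'n::finite \<Rightarrow> real) \<Rightarrow> real ^ 'n \<Rightarrow> real \<Rightarrow> real" where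
  "heat_solution \<phi> x t =
     1 / (4 * pi * t) powr (real CARD('n) / 2) *
     (LINT y|lborel. exp (- (norm (x - y))\<^sup>2 / (4 * t)) * \<phi> y)"

text \<open>The lower and upper limits are taken in the extended reals, since \<^const>\<open>Liminf\<close> and
  \<^const>\<open>Limsup\<close> require a complete lattice.\<close>

definition oscillates_between ::
    "(real ^ 'n::finite \<Rightarrow> real) \<Rightarrow> real \<Rightarrow> real \<Rightarrow> real \<Rightarrow> real \<Rightarrow> bool" where
  "oscillates_between \<phi> p \<alpha> \<beta> q \<longleftrightarrow>
     Liminf at_top (\<lambda>\<tau>. ereal (ball_average \<phi> \<tau>)) = ereal p \<and> p < \<alpha> \<and>
     Liminf at_top (\<lambda>t. ereal (heat_solution \<phi> 0 t)) = ereal \<alpha> \<and> \<alpha> < \<beta> \<and>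
     Limsup at_top (\<lambda>t. ereal (heat_solution \<phi> 0 t)) = ereal \<beta> \<and> \<beta> < q \<and>
     Limsup at_top (\<lambda>\<tau>. ereal (ball_average \<phi> \<tau>)) = ereal q"

definition profile :: "nat \<Rightarrow> real \<Rightarrow> real \<Rightarrow> real \<Rightarrow> real \<Rightarrow> real" where
  "profile n p q m \<tau> =
     (q - p) / 2 * sin (m * ln (\<tau> + 1)) +
     (q - p) / 2 * (m * \<tau> / (real n * (\<tau> + 1))) * cos (m * ln (\<tau> + 1)) +
     (q + p) / 2"

text \<open>Used with \<open>g = cos\<close> and \<open>g = sin\<close>.\<close>

definition gauss_moment :: "'n::finite itself \<Rightarrow> (real \<Rightarrow> real) \<Rightarrow> real \<Rightarrow> real" where
  "gauss_moment _ g m =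
     2 * ball_volume TYPE('n) / pi powr (real CARD('n) / 2) *
     (LINT z:{0<..}|lborel. exp (- z\<^sup>2) * z ^ (CARD('n) + 1) * g (m * ln z))"

end

theory Submission
  imports Defs "HOL-Probability.Distributions" "HOL-Real_Asymp.Real_Asymp"
begin

text \<open>
  Write \<open>f(r) = (q + p)/2 + (q - p)/2 sin(m ln(r + 1))\<close>. The profile is \<open>\<phi> = f + r f'/n\<close>, so
  \<open>(r\<^sup>n f)' = n r\<^bsup>n-1\<^esup> \<phi>\<close> and the average of \<open>\<phi>\<close> over a ball of radius \<open>\<tau>\<close> is exactly \<open>f(\<tau>)\<close>.
  Integrating by parts in polar coordinates and rescaling, the heat solution at the origin is
  \<open>2 \<omega>(n) \<pi>\<^bsup>-n/2\<^esup> \<integral> exp(-z\<^sup>2) z\<^bsup>n+1\<^esup> f(2 \<surd>t z) dz\<close>.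
  As \<open>t \<longrightarrow> \<infinity>\<close>, \<open>ln(2 \<surd>t z + 1)\<close> may be replaced by \<open>ln(2 \<surd>t) + ln z\<close>; hence the solution is
  asymptotically a sinusoid in \<open>m ln(2 \<surd>t)\<close> about \<open>(q + p)/2\<close>, whose amplitude is \<open>(q - p)/2\<close> times
  the modulus of the complex Gaussian moment. This modulus is continuous in \<open>m\<close>, equals \<open>1\<close> at \<open>m = 0\<close> and
  decays like \<open>1/m\<close>, so it takes every value in \<open>(0, 1)\<close>.
\<close>

section \<open>Upper and lower limits of asymptotically sinusoidal functions\<close>

lemma Limsup_ge_along:
  fixes u :: "real \<Rightarrow> real"
  assumes X: "filterlim X at_top sequentially" and lim: "(\<lambda>k. u (X k)) \<longlonglongrightarrow> L"
  shows "ereal L \<le> Limsup at_top (\<lambda>s. ereal (u s))"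
proof (rule ccontr)
  assume "\<not> ?thesis"
  then have "Limsup at_top (\<lambda>s. ereal (u s)) < ereal L" by simp
  then obtain y where y: "Limsup at_top (\<lambda>s. ereal (u s)) < ereal y" "ereal y < ereal L"
    using ereal_dense2 by blast
  have "eventually (\<lambda>s. u s < y) at_top"
    using Limsup_lessD[OF y(1)] by simp
  then have "eventually (\<lambda>k. u (X k) < y) sequentially"
    using X unfolding filterlim_iff by blast
  then have "L \<le> y"
    by (intro tendsto_upperbound[OF lim]) (auto elim: eventually_mono)
  with y(2) show False by simp
qed

text \<open>The upper bound holds because sine is at most 1 and \<open>r\<close> is nonnegative. For
  the lower bound, \<open>\<psi>\<close> is a right inverse of the phase \<open>\<theta>\<close>
  that tends to infinity, so every phase value can be hit exactly; the argument follows the phases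
  at which the sine is 1.\<close>

lemma Limsup_sin_phase:
  fixes u \<theta> \<psi> :: "real \<Rightarrow> real"
  assumes diff: "((\<lambda>s. u s - (c + r * sin (\<theta> s + \<delta>))) \<longlongrightarrow> 0) at_top" and r: "0 \<le> r"
    and \<psi>: "filterlim \<psi> at_top at_top" "\<And>y. \<theta> (\<psi> y) = y"
  shows "Limsup at_top (\<lambda>s. ereal (u s)) = ereal (c + r)"
proof (rule antisym)
  show "Limsup at_top (\<lambda>s. ereal (u s)) \<le> ereal (c + r)"
  proof (rule ereal_le_epsilon2)
    fix e :: real assume "0 < e"
    with diff have "eventually (\<lambda>s. \<bar>u s - (c + r * sin (\<theta> s + \<delta>))\<bar> < e) at_top"
      by (auto simp: tendsto_iff dist_real_def)
    then have "eventually (\<lambda>s. ereal (u s) \<le> ereal (c + r) + ereal e) at_top"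
    proof eventually_elim
      case (elim s)
      have "r * sin (\<theta> s + \<delta>) \<le> r * 1" using r by (intro mult_left_mono) auto
      with elim show ?case by simp
    qed
    then show "Limsup at_top (\<lambda>s. ereal (u s)) \<le> ereal (c + r) + ereal e"
      by (rule Limsup_bounded)
  qed
next
  \<comment> \<open>These are the solutions of sin(y + \<delta>) = 1, spaced by the period; the
    times \<open>\<psi> (y k)\<close> then run to infinity.\<close>
  define y where "y k = pi / 2 - \<delta> + 2 * pi * real k" for k :: nat
  have "filterlim y at_top sequentially"
    unfolding y_def
    by (intro filterlim_tendsto_add_at_top[OF tendsto_const]
        filterlim_tendsto_pos_mult_at_top[OF tendsto_const] filterlim_real_sequentially) simp
  then have X: "filterlim (\<lambda>k. \<psi> (y k)) at_top sequentially"
    by (rule filterlim_compose[OF \<psi>(1)])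
  have "sin (y k + \<delta>) = 1" for k
  proof -
    have "sin (y k + \<delta>) = cos (2 * pi * real k)"
      by (simp add: y_def sin_cos_eq)
    then show ?thesis using cos_int_2pin[of "int k"] by simp
  qed
  then have "(\<lambda>k. u (\<psi> (y k)) - (c + r)) \<longlonglongrightarrow> 0"
    using filterlim_compose[OF diff X] by (simp add: \<psi>(2))
  then have "(\<lambda>k. u (\<psi> (y k))) \<longlonglongrightarrow> c + r"
    by (simp add: LIM_zero_cancel)
  then show "ereal (c + r) \<le> Limsup at_top (\<lambda>s. ereal (u s))"
    by (rule Limsup_ge_along[OF X])
qed

text \<open>Reduces to the upper limit of \<open>- u\<close>: changing the sign of the sine amounts
  to adding pi to the phase shift, so the amplitude stays nonnegative.\<close>

lemma Liminf_sin_phase: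
  fixes u \<theta> \<psi> :: "real \<Rightarrow> real"
  assumes diff: "((\<lambda>s. u s - (c + r * sin (\<theta> s + \<delta>))) \<longlongrightarrow> 0) at_top" and r: "0 \<le> r"
    and \<psi>: "filterlim \<psi> at_top at_top" "\<And>y. \<theta> (\<psi> y) = y"
  shows "Liminf at_top (\<lambda>s. ereal (u s)) = ereal (c - r)"
proof -
  have "(\<lambda>s. - u s - (- c + r * sin (\<theta> s + (\<delta> + pi)))) =
        (\<lambda>s. - (u s - (c + r * sin (\<theta> s + \<delta>))))"
    by (simp add: fun_eq_iff flip: add.assoc)
  then have "((\<lambda>s. - u s - (- c + r * sin (\<theta> s + (\<delta> + pi)))) \<longlongrightarrow> 0) at_top"
    using tendsto_minus[OF diff] by simp
  from Limsup_sin_phase[OF this r \<psi>]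
  have "Limsup at_top (\<lambda>s. - ereal (u s)) = ereal (- c + r)"
    by (simp only: uminus_ereal.simps)
  then have "- Liminf at_top (\<lambda>s. ereal (u s)) = ereal (- c + r)"
    by (simp only: ereal_Limsup_uminus)
  then show ?thesis
    by (metis ereal_uminus_uminus minus_add_distrib minus_minus uminus_ereal.simps(1) diff_conv_add_uminus)
qed

section \<open>Gaussian integrals on the half-line and integration by parts\<close>

lemma gaussian_set_integrable:
  "set_integrable lborel {0<..} (\<lambda>z::real. exp (- z\<^sup>2) * z ^ k)"
proof -
  have "set_integrable lborel {0..} (\<lambda>z::real. exp (- z\<^sup>2) * z ^ k)"
  proof (cases "even k")
    case True
    then obtain j where "k = 2 * j" by (elim evenE)
    then show ?thesis using gaussian_moment_even_pos[of j]
      by (auto simp: set_integrable_def has_bochner_integral_iff)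
  next
    case False
    then obtain j where "k = 2 * j + 1" by (elim oddE)
    then show ?thesis using gaussian_moment_odd_pos[of j]
      by (auto simp: set_integrable_def has_bochner_integral_iff)
  qed
  then show ?thesis by (rule set_integrable_subset) auto
qed

text \<open>Both sides are Gamma(n/2 + 1)/2. The proof compares the factorial formulas for the
  moments and for the ball volume, separately for even and odd \<open>n\<close>.\<close>

lemma gaussian_half_line_moment:
  "(LINT z:{0<..}|lborel. exp (- z\<^sup>2) * z ^ Suc n) =
    pi powr (real n / 2) / (2 * unit_ball_vol (real n))"
proof -
  \<comment> \<open>The known moments are stated over the closed half-line; the two domains differ
    by the null set {0}.\<close>
  have eq: "(LINT z:{0<..}|lborel. exp (- z\<^sup>2) * z ^ j) =
        (LINT z::real|lborel. indicator {0..} z *\<^sub>R (exp (- z\<^sup>2) * z ^ j))" for j :: nat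
    unfolding set_lebesgue_integral_def
    by (rule integral_cong_AE, measurable)
       (use AE_lborel_singleton[of 0] in eventually_elim, auto split: split_indicator)
  show ?thesis
  proof (cases "even n")
    case True
    then obtain j where j: "n = 2 * j" by (elim evenE)
    have "(LINT z:{0<..}|lborel. exp (- z\<^sup>2) * z ^ Suc n) = (fact j / 2 :: real)"
      using gaussian_moment_odd_pos[of j] unfolding eq j
      by (simp add: has_bochner_integral_iff)
    also have "\<dots> = pi powr (real n / 2) / (2 * unit_ball_vol (real n))"
      unfolding j unit_ball_vol_even by (simp add: powr_realpow)
    finally show ?thesis .
  next
    case False
    then obtain j where j: "n = 2 * j + 1" by (elim oddE)
    have "(LINT z:{0<..}|lborel. exp (- z\<^sup>2) * z ^ Suc n) =
        (sqrt pi / 2) * (fact (2 * Suc j) / (2 ^ (2 * Suc j) * fact (Suc j)))"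
      using gaussian_moment_even_pos[of "Suc j"] unfolding eq j
      by (simp add: has_bochner_integral_iff del: fact_Suc)
    also have "\<dots> = pi powr (real n / 2) / (2 * unit_ball_vol (real n))"
    proof -
      have "pi powr (real n / 2) = pi ^ j * sqrt pi"
        unfolding j by (simp add: add_divide_distrib powr_add powr_realpow powr_half_sqrt)
      then show ?thesis
        unfolding j unit_ball_vol_odd by (simp del: fact_Suc)
    qed
    finally show ?thesis .
  qed
qed

lemma gaussian_bounded_set_integrable:
  fixes h :: "real \<Rightarrow> real"
  assumes [measurable]: "h \<in> borel_measurable borel" and B: "\<And>z. 0 < z \<Longrightarrow> \<bar>h z\<bar> \<le> B"
  shows "set_integrable lborel {0<..} (\<lambda>z. exp (- z\<^sup>2) * z ^ k * h z)"
proof (rule set_integrable_bound)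
  show "set_integrable lborel {0<..} (\<lambda>z. B * (exp (- z\<^sup>2) * z ^ k))"
    by (intro set_integrable_mult_right gaussian_set_integrable)
  show "set_borel_measurable lborel {0<..} (\<lambda>z. exp (- z\<^sup>2) * z ^ k * h z)"
    unfolding set_borel_measurable_def by measurable
  show "AE z in lborel. z \<in> {0<..} \<longrightarrow>
      norm (exp (- z\<^sup>2) * z ^ k * h z) \<le> norm (B * (exp (- z\<^sup>2) * z ^ k))"
  proof (intro AE_I2 impI)
    fix z :: real assume "z \<in> {0<..}"
    then have "\<bar>h z\<bar> \<le> \<bar>B\<bar>" using B[of z] by auto
    then show "norm (exp (- z\<^sup>2) * z ^ k * h z) \<le> norm (B * (exp (- z\<^sup>2) * z ^ k))"
      by (auto simp: abs_mult mult.commute intro!: mult_right_mono mult_left_mono)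
  qed
qed

lemma gaussian_integral_bound:
  fixes h :: "real \<Rightarrow> real"
  assumes "h \<in> borel_measurable borel" "\<And>z. 0 < z \<Longrightarrow> \<bar>h z\<bar> \<le> B"
  shows "\<bar>LINT z:{0<..}|lborel. exp (- z\<^sup>2) * z ^ k * h z\<bar>
      \<le> B * (LINT z:{0<..}|lborel. exp (- z\<^sup>2) * z ^ k)"
proof -
  have "norm (LINT z:{0<..}|lborel. exp (- z\<^sup>2) * z ^ k * h z)
      \<le> (LINT z:{0<..}|lborel. norm (exp (- z\<^sup>2) * z ^ k * h z))"
    by (rule set_integral_norm_bound[OF gaussian_bounded_set_integrable[OF assms]])
  also have "\<dots> \<le> (LINT z:{0<..}|lborel. B * (exp (- z\<^sup>2) * z ^ k))"
    using gaussian_bounded_set_integrable[OF assms]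
    by (intro set_integral_mono set_integrable_norm set_integrable_mult_right
        gaussian_set_integrable) (auto simp: abs_mult mult.commute intro!: mult_left_mono assms)
  finally show ?thesis by simp
qed

text \<open>The difference of the two integrands is the derivative of exp(-z^2) z^(k+1) h(z), which
  vanishes at both ends of the half-line because \<open>h\<close> is bounded. The bound on z h'(z),
  rather than on h'(z), suffices for integrability and is unaffected by rescaling z, so it also
  admits functions of ln z.\<close>

lemma gaussian_by_parts:
  fixes h h' :: "real \<Rightarrow> real"
  assumes meas[measurable]: "h \<in> borel_measurable borel" "h' \<in> borel_measurable borel"
    and deriv: "\<And>z. 0 < z \<Longrightarrow> (h has_real_derivative h' z) (at z)"
    and cont: "\<And>z. 0 < z \<Longrightarrow> isCont h' z"
    and B: "\<And>z. 0 < z \<Longrightarrow> \<bar>h z\<bar> \<le> B" and B': "\<And>z. 0 < z \<Longrightarrow> \<bar>z * h' z\<bar> \<le> B'"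
  shows "(LINT z:{0<..}|lborel. exp (- z\<^sup>2) * z ^ k * (real (Suc k) * h z + z * h' z)) =
         2 * (LINT z:{0<..}|lborel. exp (- z\<^sup>2) * z ^ (k + 2) * h z)"
proof -
  define F where "F z = exp (- z\<^sup>2) * z ^ Suc k * h z" for z
  have B2: "\<bar>real (Suc k) * h z + z * h' z\<bar> \<le> real (Suc k) * B + B'" if "0 < z" for z
  proof -
    have "\<bar>real (Suc k) * h z + z * h' z\<bar> \<le> real (Suc k) * \<bar>h z\<bar> + \<bar>z * h' z\<bar>"
      by (rule order_trans[OF abs_triangle_ineq]) (simp add: abs_mult)
    also have "\<dots> \<le> real (Suc k) * B + B'"
      using B[OF that] B'[OF that] by (intro add_mono mult_left_mono) auto
    finally show ?thesis .
  qed
  let ?f1 = "\<lambda>z. exp (- z\<^sup>2) * z ^ k * (real (Suc k) * h z + z * h' z)"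
  let ?f2 = "\<lambda>z. exp (- z\<^sup>2) * z ^ (k + 2) * h z"
  have int1: "set_integrable lborel {0<..} ?f1"
    by (rule gaussian_bounded_set_integrable[OF _ B2]) auto
  have int2: "set_integrable lborel {0<..} (\<lambda>z. 2 * ?f2 z)"
    by (intro set_integrable_mult_right gaussian_bounded_set_integrable[OF _ B]) auto
  have int: "set_integrable lborel {0<..} (\<lambda>z. ?f1 z - 2 * ?f2 z)"
    using int1 int2 by (rule set_integral_diff)
  have Fbound: "norm (F z) \<le> norm (B * (exp (- z\<^sup>2) * z ^ Suc k))" if "0 < z" for z
    using mult_left_mono[of "\<bar>h z\<bar>" "\<bar>B\<bar>" "\<bar>exp (- z\<^sup>2) * z ^ Suc k\<bar>"] B[OF that]
    by (simp add: F_def abs_mult mult_ac)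
  have "(LBINT z=ereal 0..\<infinity>. ?f1 z - 2 * ?f2 z) = 0 - 0"
  proof (rule interval_integral_FTC_integrable[where F = F])
    fix z assume "ereal 0 < ereal z"
    then have z: "0 < z" by simp
    have "(F has_real_derivative ?f1 z - 2 * ?f2 z) (at z)"
      unfolding F_def
      by (rule derivative_eq_intros deriv[OF z] refl)+
         (simp add: algebra_simps power2_eq_square)
    then show "(F has_vector_derivative ?f1 z - 2 * ?f2 z) (at z)"
      by (simp add: has_real_derivative_iff_has_vector_derivative)
    show "isCont (\<lambda>z. ?f1 z - 2 * ?f2 z) z"
      by (intro continuous_intros cont[OF z] DERIV_isCont[OF deriv[OF z]])
  next
    show "set_integrable lborel (einterval (ereal 0) \<infinity>) (\<lambda>z. ?f1 z - 2 * ?f2 z)"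
      using int by simp
    \<comment> \<open>The exponent \<open>Suc k\<close> is positive even for k = 0, so the power
      forces the limit 0 at the origin.\<close>
    have "(F \<longlongrightarrow> 0) (at_right 0)"
    proof (rule Lim_null_comparison)
      show "eventually (\<lambda>z. norm (F z) \<le> norm (B * (exp (- z\<^sup>2) * z ^ Suc k))) (at_right 0)"
        using Fbound by (auto simp: eventually_at_filter)
      have "((\<lambda>z::real. norm (B * (exp (- z\<^sup>2) * z ^ Suc k))) \<longlongrightarrow>
          norm (B * (exp (- 0\<^sup>2) * 0 ^ Suc k))) (at_right 0)"
        by (intro tendsto_intros)
      then show "((\<lambda>z::real. norm (B * (exp (- z\<^sup>2) * z ^ Suc k))) \<longlongrightarrow> 0) (at_right 0)"
        by simp
    qed
    then show "((F \<circ> real_of_ereal) \<longlongrightarrow> 0) (at_right (ereal 0))"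
      by (simp add: ereal_tendsto_simps1)
    have "(F \<longlongrightarrow> 0) at_top"
    proof (rule Lim_null_comparison)
      show "eventually (\<lambda>z. norm (F z) \<le> norm (B * (exp (- z\<^sup>2) * z ^ Suc k))) at_top"
        using eventually_gt_at_top[of 0] by eventually_elim (rule Fbound)
      have "((\<lambda>z::real. exp (- z\<^sup>2) * z ^ Suc k) \<longlongrightarrow> 0) at_top"
        by real_asymp
      then have "((\<lambda>z::real. norm (B * (exp (- z\<^sup>2) * z ^ Suc k))) \<longlongrightarrow> norm (B * 0)) at_top"
        by (intro tendsto_norm tendsto_mult_left)
      then show "((\<lambda>z::real. norm (B * (exp (- z\<^sup>2) * z ^ Suc k))) \<longlongrightarrow> 0) at_top"
        by simp
    qed
    then show "((F \<circ> real_of_ereal) \<longlongrightarrow> 0) (at_left \<infinity>)"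
      by (simp add: ereal_tendsto_simps1)
  qed simp
  then have "(LINT z:{0<..}|lborel. ?f1 z - 2 * ?f2 z) = 0"
    by (simp add: interval_lebesgue_integral_0_infty flip: zero_ereal_def)
  then show ?thesis
    using set_integral_diff(2)[OF int1 int2] by simp
qed

section \<open>Polar coordinates for radial functions\<close>

lemma ball_volume_eq: "ball_volume TYPE('n::finite) = unit_ball_vol (real CARD('n))"
  by (simp add: ball_volume_def content_ball)

lemma ball_volume_pos: "0 < ball_volume TYPE('n::finite)"
  by (simp add: ball_volume_eq)

text \<open>Polar coordinates without a surface measure: the image of Lebesgue measure under the
  norm is determined by its values on the sets {..a}, which are the volumes \<omega>(n) a^n of
  balls. The density is the derivative of this power. The sets {..a} are stable under intersection
  and generate the Borel sets, so agreement on them is enough.\<close>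

lemma distr_norm_lborel:
  "distr (lborel :: (real ^ 'n::finite) measure) borel norm =
   density lborel (\<lambda>r. ennreal (indicator {0<..} r *
     (real CARD('n) * ball_volume TYPE('n) * r ^ (CARD('n) - 1))))"
    (is "?M = ?N")
proof (rule measure_eqI_generator_eq[where E = "range (\<lambda>a::real. {..a})" and \<Omega> = UNIV
        and A = "\<lambda>i::nat. {..real i}"])
  let ?n = "CARD('n)" and ?w = "ball_volume TYPE('n)"
  have n: "0 < ?n" by simp
  have w: "0 < ?w" by (rule ball_volume_pos)
  have M: "emeasure ?M {..a} = ennreal (if a < 0 then 0 else ?w * a ^ ?n)" for a
  proof -
    have "emeasure ?M {..a} = emeasure lborel (cball (0 :: real ^ 'n) a)"
      by (subst emeasure_distr) (auto simp: cball_def intro!: arg_cong[of _ _ "emeasure lborel"])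
    also have "\<dots> = ennreal (if a < 0 then 0 else ?w * a ^ ?n)"
      by (auto simp: emeasure_cball ball_volume_eq)
    finally show ?thesis .
  qed
  have N: "emeasure ?N {..a} = ennreal (if a < 0 then 0 else ?w * a ^ ?n)" for a
  proof -
    have "emeasure ?N {..a} =
        (\<integral>\<^sup>+r. ennreal (indicator {0<..} r * (real ?n * ?w * r ^ (?n - 1))) * indicator {..a} r \<partial>lborel)"
      by (rule emeasure_density) auto
    \<comment> \<open>Adding the null point 0 gives a compact interval for the fundamental theorem;
      for negative \<open>a\<close> both domains are empty.\<close>
    also have "\<dots> = (\<integral>\<^sup>+r. ennreal (real ?n * ?w * r ^ (?n - 1)) * indicator {0..a} r \<partial>lborel)"
      by (rule nn_integral_cong_AE)
         (use AE_lborel_singleton[of 0] in eventually_elim, auto split: split_indicator)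
    also have "\<dots> = ennreal (if a < 0 then 0 else ?w * a ^ ?n)"
    proof (cases "a < 0")
      case False
      have "(\<integral>\<^sup>+r. ennreal (real ?n * ?w * r ^ (?n - 1)) * indicator {0..a} r \<partial>lborel) =
          ennreal (?w * a ^ ?n - ?w * 0 ^ ?n)"
        using False w
        by (intro nn_integral_FTC_Icc) (auto intro!: derivative_eq_intros)
      then show ?thesis using False by (simp add: zero_power)
    qed auto
    finally show ?thesis .
  qed
  show "emeasure ?M X = emeasure ?N X" if "X \<in> range (\<lambda>a. {..a})" for X
    using that M N by auto
  show "Int_stable (range (\<lambda>a::real. {..a}))"
    by (auto simp: Int_stable_def)
  show "sets ?M = sigma_sets UNIV (range (\<lambda>a. {..a}))"
       "sets ?N = sigma_sets UNIV (range (\<lambda>a. {..a}))"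
    by (simp_all add: borel_eq_atMost)
  show "emeasure ?M {..real i} \<noteq> \<infinity>" for i
    unfolding M by simp
  show "(\<Union>i. {..real i}) = UNIV"
    by (auto intro: real_arch_simple)
qed auto

lemma integral_radial:
  fixes g :: "real \<Rightarrow> real"
  assumes [measurable]: "g \<in> borel_measurable borel"
  shows "(LINT y|(lborel :: (real ^ 'n::finite) measure). g (norm y)) =
    real CARD('n) * ball_volume TYPE('n) * (LINT r:{0<..}|lborel. r ^ (CARD('n) - 1) * g r)"
proof -
  let ?c = "real CARD('n) * ball_volume TYPE('n)"
  have "(LINT y|(lborel :: (real ^ 'n) measure). g (norm y)) =
      integral\<^sup>L (distr (lborel :: (real ^ 'n) measure) borel norm) g"
    by (rule integral_distr[symmetric]) auto
  also have "\<dots> = (LINT r|lborel. (indicator {0<..} r * (?c * r ^ (CARD('n) - 1))) *\<^sub>R g r)"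
    unfolding distr_norm_lborel
    by (rule integral_density) (auto simp: less_imp_le[OF ball_volume_pos] split: split_indicator)
  also have "\<dots> = (LINT r|lborel. ?c * (indicator {0<..} r *\<^sub>R (r ^ (CARD('n) - 1) * g r)))"
    by (simp add: mult_ac)
  also have "\<dots> = ?c * (LINT r:{0<..}|lborel. r ^ (CARD('n) - 1) * g r)"
    by (simp add: set_lebesgue_integral_def)
  finally show ?thesis .
qed

section \<open>The profile, its ball mean f, and uniform bounds\<close>

definition mean_profile :: "real \<Rightarrow> real \<Rightarrow> real \<Rightarrow> real \<Rightarrow> real" where
  "mean_profile p q m r = (q + p) / 2 + (q - p) / 2 * sin (m * ln (r + 1))"

definition mean_profile' :: "real \<Rightarrow> real \<Rightarrow> real \<Rightarrow> real \<Rightarrow> real" where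
  "mean_profile' p q m r = (q - p) / 2 * (m / (r + 1) * cos (m * ln (r + 1)))"

text \<open>Multiplied by r^(n-1), the right-hand side is the derivative of r^n f(r). Both the ball
  average and the heat integral of the profile are reduced to \<open>mean_profile\<close> through
  this identity.\<close>

lemma profile_eq:
  assumes "0 < n"
  shows "real n * profile n p q m r = real n * mean_profile p q m r + r * mean_profile' p q m r"
proof -
  have X: "real n * (m * r / (real n * (r + 1))) = r * (m / (r + 1))"
    using assms by simp
  \<comment> \<open>The sine, the cosine and the fraction are replaced by variables, leaving a
    polynomial identity.\<close>
  have key: "N * (a * S + a * x * C + d) = N * (d + a * S) + a * (N * x) * C"
    for N a S x C d :: real
    by (simp add: algebra_simps)
  show ?thesis
    unfolding profile_def mean_profile_def mean_profile'_def key X by (simp only: mult_ac)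
qed

lemma mean_profile_deriv:
  assumes "0 \<le> r"
  shows "(mean_profile p q m has_real_derivative mean_profile' p q m r) (at r)"
proof -
  have "((\<lambda>r. c + a * sin (m * ln (r + 1))) has_real_derivative
      a * (m / (r + 1) * cos (m * ln (r + 1)))) (at r)" for a c :: real
    using assms by (auto intro!: derivative_eq_intros)
  then show ?thesis
    unfolding mean_profile_def mean_profile'_def .
qed

lemma mean_profile_measurable [measurable]:
  "mean_profile p q m \<in> borel_measurable borel" "mean_profile' p q m \<in> borel_measurable borel"
  "profile n p q m \<in> borel_measurable borel"
  unfolding mean_profile_def mean_profile'_def profile_def by measurable

lemma isCont_mean_profile':
  "0 \<le> r \<Longrightarrow> isCont (mean_profile' p q m) r"
  unfolding mean_profile'_def by (intro continuous_intros) auto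

lemma isCont_profile:
  "0 < n \<Longrightarrow> 0 \<le> r \<Longrightarrow> isCont (profile n p q m) r"
  unfolding profile_def by (intro continuous_intros) auto

lemma abs_mult_le_of_le_one:
  fixes a s :: real
  assumes "\<bar>s\<bar> \<le> 1"
  shows "\<bar>a * s\<bar> \<le> \<bar>a\<bar>"
  using mult_left_mono[OF assms, of "\<bar>a\<bar>"] by (simp add: abs_mult)

lemma abs_mean_profile_le:
  "\<bar>mean_profile p q m r\<bar> \<le> \<bar>(q + p) / 2\<bar> + \<bar>(q - p) / 2\<bar>"
  unfolding mean_profile_def
  by (rule order_trans[OF abs_triangle_ineq]) (intro add_mono order_refl abs_mult_le_of_le_one, simp)

text \<open>The factor r/(r + 1) is at most 1, so the bound is uniform in r. Evaluated at s z, it is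
  the hypothesis on z h'(z) in \<open>gaussian_by_parts\<close>, with a constant independent of the
  scale s.\<close>

lemma abs_mult_mean_profile'_le:
  assumes "0 \<le> r"
  shows "\<bar>r * mean_profile' p q m r\<bar> \<le> \<bar>(q - p) / 2 * m\<bar>"
proof -
  have "\<bar>r / (r + 1) * cos (m * ln (r + 1))\<bar> \<le> 1"
    by (rule order_trans[OF abs_mult_le_of_le_one[OF abs_cos_le_one]]) (use assms in simp)
  moreover have "r * mean_profile' p q m r = (q - p) / 2 * m * (r / (r + 1) * cos (m * ln (r + 1)))"
    by (simp add: mean_profile'_def)
  ultimately show ?thesis by (simp only: abs_mult_le_of_le_one)
qed

lemma abs_profile_le:
  assumes "0 < n" "0 \<le> r"
  shows "\<bar>profile n p q m r\<bar> \<le> \<bar>(q + p) / 2\<bar> + \<bar>(q - p) / 2\<bar> + \<bar>(q - p) / 2 * m\<bar>"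
proof -
  have "profile n p q m r = mean_profile p q m r + r * mean_profile' p q m r / real n"
    using profile_eq[OF assms(1), of p q m r] assms(1) by (simp add: field_simps)
  moreover have "\<bar>r * mean_profile' p q m r / real n\<bar> \<le> \<bar>r * mean_profile' p q m r\<bar>"
    using assms(1) by (simp add: divide_le_eq mult_le_cancel_left1) 
  ultimately show ?thesis
    using abs_mean_profile_le[of p q m r] abs_mult_mean_profile'_le[OF assms(2), of p q m]
    by linarith
qed

lemma ball_average_profile:
  assumes "0 < \<tau>"
  shows "ball_average (\<lambda>x :: real ^ 'n::finite. profile CARD('n) p q m (norm x)) \<tau> = mean_profile p q m \<tau>"
proof -
  let ?n = "CARD('n)" and ?w = "ball_volume TYPE('n)"
  let ?\<phi> = "profile ?n p q m" and ?f = "mean_profile p q m"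
  have n: "0 < ?n" by simp
  have "(LINT y:ball (0 :: real ^ 'n) \<tau>|lborel. ?\<phi> (norm y)) =
      (LINT y|(lborel :: (real ^ 'n) measure). indicator {..<\<tau>} (norm y) * ?\<phi> (norm y))"
    unfolding set_lebesgue_integral_def
    by (intro Bochner_Integration.integral_cong) (auto split: split_indicator)
  also have "\<dots> = real ?n * ?w * (LINT r:{0<..}|lborel. r ^ (?n - 1) * (indicator {..<\<tau>} r * ?\<phi> r))"
    by (rule integral_radial) measurable
  also have "\<dots> = ?w * (LINT r|lborel. real ?n * (indicator {0<..} r *\<^sub>R (r ^ (?n - 1) * (indicator {..<\<tau>} r * ?\<phi> r))))"
    by (simp add: set_lebesgue_integral_def)
  \<comment> \<open>The open interval (0, \<tau>) is replaced by [0, \<tau>], at the cost of the two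
    null endpoints.\<close>
  also have "(LINT r|lborel. real ?n * (indicator {0<..} r *\<^sub>R (r ^ (?n - 1) * (indicator {..<\<tau>} r * ?\<phi> r)))) =
      (LINT r|lborel. (real ?n * r ^ (?n - 1) * ?\<phi> r) * indicator {0..\<tau>} r)"
    by (rule integral_cong_AE, measurable)
       (use AE_lborel_singleton[of 0] AE_lborel_singleton[of \<tau>] in eventually_elim,
        auto split: split_indicator)
  \<comment> \<open>The integrand is the derivative of r^n f(r); the boundary term at 0 drops out
    because n is positive.\<close>
  also have "\<dots> = \<tau> ^ ?n * ?f \<tau> - 0 ^ ?n * ?f 0"
  proof (rule integral_FTC_Icc_real)
    fix r :: real assume r: "0 \<le> r"
    have "r * r ^ (?n - 1) = r ^ ?n"
      using n by (metis power_eq_if neq0_conv)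
    moreover have "real ?n * r ^ (?n - 1) * ?\<phi> r = r ^ (?n - 1) * (real ?n * ?\<phi> r)"
      by simp
    ultimately have eq: "real ?n * r ^ (?n - 1) * ?\<phi> r =
        real ?n * r ^ (?n - 1) * ?f r + mean_profile' p q m r * r ^ ?n"
      unfolding profile_eq[OF n] by (simp add: distrib_left mult_ac)
    show "((\<lambda>r. r ^ ?n * ?f r) has_real_derivative real ?n * r ^ (?n - 1) * ?\<phi> r) (at r)"
      unfolding eq by (rule derivative_eq_intros mean_profile_deriv[OF r] refl)+ simp
    show "isCont (\<lambda>r. real ?n * r ^ (?n - 1) * ?\<phi> r) r"
      by (intro continuous_intros isCont_profile[OF n r])
  qed (use assms in simp)
  finally have "(LINT y:ball (0 :: real ^ 'n) \<tau>|lborel. ?\<phi> (norm y)) = ?w * (\<tau> ^ ?n * ?f \<tau>)"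
    using n by simp
  then show ?thesis
    using assms ball_volume_pos[where 'n='n] by (simp add: ball_average_def)
qed

section \<open>The heat solution at the origin and its large-time asymptotics\<close>

lemma heat_solution_profile:
  assumes "0 < t"
  shows "heat_solution (\<lambda>x :: real ^ 'n::finite. profile CARD('n) p q m (norm x)) 0 t =
    2 * ball_volume TYPE('n) / pi powr (real CARD('n) / 2) *
    (LINT z:{0<..}|lborel. exp (- z\<^sup>2) * z ^ (CARD('n) + 1) * mean_profile p q m (2 * sqrt t * z))"
proof -
  let ?n = "CARD('n)" and ?w = "ball_volume TYPE('n)"
  let ?\<phi> = "profile ?n p q m" and ?f = "mean_profile p q m" and ?f' = "mean_profile' p q m"
  \<comment> \<open>This scale turns the heat kernel exp(-r^2/(4t)) into exp(-z^2) under the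
    substitution r = s z.\<close>
  define s where "s = 2 * sqrt t"
  have s: "0 < s" "s\<^sup>2 = 4 * t"
    using assms by (auto simp: s_def power_mult_distrib)
  have n: "0 < ?n" by simp
  have "(LINT y|(lborel :: (real ^ 'n) measure). exp (- (norm (0 - y))\<^sup>2 / (4 * t)) * ?\<phi> (norm y)) =
      real ?n * ?w * (LINT r:{0<..}|lborel. r ^ (?n - 1) * (exp (- r\<^sup>2 / (4 * t)) * ?\<phi> r))"
    by (subst integral_radial[symmetric]) auto
  also have "(LINT r:{0<..}|lborel. r ^ (?n - 1) * (exp (- r\<^sup>2 / (4 * t)) * ?\<phi> r)) =
      s * (LINT z:{0<..}|lborel. (s * z) ^ (?n - 1) * (exp (- (s * z)\<^sup>2 / (4 * t)) * ?\<phi> (s * z)))"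
  proof -
    \<comment> \<open>Since s is positive, the substitution maps the half-line onto itself.\<close>
    have "indicator {0<..} (s * z) = (indicator {0<..} z :: real)" for z
      using s by (auto simp: indicator_def zero_less_mult_iff)
    then show ?thesis
      unfolding set_lebesgue_integral_def
      using s by (subst lborel_integral_real_affine[of s _ 0]) auto
  qed
  also have "\<dots> = s ^ ?n * (LINT z:{0<..}|lborel. exp (- z\<^sup>2) * z ^ (?n - 1) * ?\<phi> (s * z))"
  proof -
    have "(s * z)\<^sup>2 / (4 * t) = z\<^sup>2" for z
      using assms by (simp add: power_mult_distrib s)
    then have "(s * z) ^ (?n - 1) * (exp (- (s * z)\<^sup>2 / (4 * t)) * ?\<phi> (s * z)) =
        s ^ (?n - 1) * (exp (- z\<^sup>2) * z ^ (?n - 1) * ?\<phi> (s * z))" for z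
      by (simp add: power_mult_distrib)
    moreover have "s ^ ?n = s * s ^ (?n - 1)"
      using n by (metis power_eq_if neq0_conv)
    ultimately show ?thesis
      by (simp only: set_integral_mult_right mult.assoc)
  qed
  finally have I: "(LINT y|(lborel :: (real ^ 'n) measure). exp (- (norm (0 - y))\<^sup>2 / (4 * t)) * ?\<phi> (norm y)) =
      s ^ ?n * ?w * (real ?n * (LINT z:{0<..}|lborel. exp (- z\<^sup>2) * z ^ (?n - 1) * ?\<phi> (s * z)))"
    by simp
  have "real ?n * (LINT z:{0<..}|lborel. exp (- z\<^sup>2) * z ^ (?n - 1) * ?\<phi> (s * z)) =
      (LINT z:{0<..}|lborel. real ?n * (exp (- z\<^sup>2) * z ^ (?n - 1) * ?\<phi> (s * z)))"
    by simp
  \<comment> \<open>The factor n is written as \<open>Suc (n - 1)\<close> to fit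
    \<open>gaussian_by_parts\<close> with k = n - 1 and h(z) = f(s z), whose derivative is f'(s z)
    s. The power produced there is k + 2 = n + 1.\<close>
  also have "\<dots> = (LINT z:{0<..}|lborel. exp (- z\<^sup>2) * z ^ (?n - 1) *
        (real (Suc (?n - 1)) * ?f (s * z) + z * (?f' (s * z) * s)))"
  proof -
    have "real ?n * (a * ?\<phi> (s * z)) = a * (real (Suc (?n - 1)) * ?f (s * z) + z * (?f' (s * z) * s))"
      for z a :: real
    proof -
      have "real ?n * (a * ?\<phi> (s * z)) = a * (real ?n * ?\<phi> (s * z))" by simp
      then show ?thesis
        unfolding profile_eq[OF n] Suc_diff_1[OF n] by (simp add: mult_ac)
    qed
    then show ?thesis by (simp only:)
  qed
  also have "\<dots> = 2 * (LINT z:{0<..}|lborel. exp (- z\<^sup>2) * z ^ (?n - 1 + 2) * ?f (s * z))"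
  proof (rule gaussian_by_parts)
    fix z :: real assume "0 < z"
    then have sz: "0 \<le> s * z" using s by simp
    show "((\<lambda>z. ?f (s * z)) has_real_derivative ?f' (s * z) * s) (at z)"
      using DERIV_chain2[OF mean_profile_deriv[OF sz] DERIV_cmult_Id] .
    have "isCont (\<lambda>z. ?f' (s * z)) z"
      by (rule isCont_o2[where f = "(*) s" and g = ?f']) (auto intro: isCont_mean_profile'[OF sz])
    then show "isCont (\<lambda>z. ?f' (s * z) * s) z"
      by (intro continuous_intros)
    show "\<bar>z * (?f' (s * z) * s)\<bar> \<le> \<bar>(q - p) / 2 * m\<bar>"
      using abs_mult_mean_profile'_le[OF sz, of p q m] by (simp add: mult_ac)
  qed (use abs_mean_profile_le in auto)
  finally have J: "real ?n * (LINT z:{0<..}|lborel. exp (- z\<^sup>2) * z ^ (?n - 1) * ?\<phi> (s * z)) =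
      2 * (LINT z:{0<..}|lborel. exp (- z\<^sup>2) * z ^ (?n + 1) * ?f (s * z))"
    using n by simp
  \<comment> \<open>The normalisation of the kernel cancels the factor s^n coming from the Jacobian
    and the radial weight.\<close>
  have "(4 * pi * t) powr (real ?n / 2) = pi powr (real ?n / 2) * s ^ ?n"
  proof -
    have "(4 * pi * t) powr (real ?n / 2) = pi powr (real ?n / 2) * (s\<^sup>2) powr (real ?n / 2)"
      using assms by (simp add: s powr_mult[symmetric] mult_ac)
    also have "(s\<^sup>2) powr (real ?n / 2) = s ^ ?n"
      using s(1) by (simp add: powr_powr powr_realpow flip: powr_numeral)
    finally show ?thesis .
  qed
  then show ?thesis
    unfolding heat_solution_def I J using s(1) by (simp add: s_def)
qed

text \<open>By the addition formula the subtracted terms are the integral of sin(m ln s + m ln z).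
  For fixed z > 0 the two phases differ by a quantity tending to 0 as s grows, and sine is
  1-Lipschitz. Dominated convergence, with twice the Gaussian weight as majorant, carries this over
  to the integrals.\<close>

lemma gaussian_sin_ln_asymptotic:
  fixes m :: real
  shows "((\<lambda>s. (LINT z:{0<..}|lborel. exp (- z\<^sup>2) * z ^ k * sin (m * ln (s * z + 1))) -
      (sin (m * ln s) * (LINT z:{0<..}|lborel. exp (- z\<^sup>2) * z ^ k * cos (m * ln z)) +
       cos (m * ln s) * (LINT z:{0<..}|lborel. exp (- z\<^sup>2) * z ^ k * sin (m * ln z)))) \<longlongrightarrow> 0) at_top"
proof -
  let ?d = "\<lambda>(s :: real) (z :: real). sin (m * ln (s * z + 1)) - sin (m * ln s + m * ln z)"
  have "((\<lambda>s. LINT z|lborel. indicator {0<..} z *\<^sub>R (exp (- z\<^sup>2) * z ^ k * ?d s z)) \<longlongrightarrow>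
      (LINT z|(lborel :: real measure). 0)) at_top"
  proof (rule integral_dominated_convergence_at_top)
    show "integrable lborel (\<lambda>z::real. indicator {0<..} z *\<^sub>R (2 * (exp (- z\<^sup>2) * z ^ k)))"
      using set_integrable_mult_right[of 2 lborel "{0<..}", OF gaussian_set_integrable[of k]]
      by (simp add: set_integrable_def)
    show "AE z in lborel. ((\<lambda>s. indicator {0<..} z *\<^sub>R (exp (- z\<^sup>2) * z ^ k * ?d s z)) \<longlongrightarrow> 0) at_top"
    proof (rule AE_I2)
      fix z :: real
      show "((\<lambda>s. indicator {0<..} z *\<^sub>R (exp (- z\<^sup>2) * z ^ k * ?d s z)) \<longlongrightarrow> 0) at_top"
      proof (cases "0 < z")
        case True
        have "((\<lambda>s. m * ln (s * z + 1) - (m * ln s + m * ln z)) \<longlongrightarrow> 0) at_top"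
          using True by real_asymp
        then have lim: "((\<lambda>s. \<bar>m * ln (s * z + 1) - (m * ln s + m * ln z)\<bar>) \<longlongrightarrow> 0) at_top"
          by (rule tendsto_rabs_zero)
        have "((\<lambda>s. ?d s z) \<longlongrightarrow> 0) at_top"
        proof (rule Lim_null_comparison[OF _ lim], intro always_eventually allI)
          fix s
          let ?x = "m * ln (s * z + 1)" and ?y = "m * ln s + m * ln z"
          \<comment> \<open>The Lipschitz bound for sine, from the sum-to-product formula and |sin
            x| \<le> |x|.\<close>
          have "\<bar>sin ?x - sin ?y\<bar> = 2 * (\<bar>sin ((?x - ?y) / 2)\<bar> * \<bar>cos ((?x + ?y) / 2)\<bar>)"
            by (simp add: sin_diff_sin abs_mult)
          also have "\<dots> \<le> 2 * (\<bar>(?x - ?y) / 2\<bar> * 1)"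
            by (intro mult_left_mono mult_mono abs_sin_x_le_abs_x) auto
          finally show "norm (?d s z) \<le> \<bar>?x - ?y\<bar>" by simp
        qed
        then have "((\<lambda>s. indicator {0<..} z *\<^sub>R (exp (- z\<^sup>2) * z ^ k * ?d s z)) \<longlongrightarrow>
            indicator {0<..} z *\<^sub>R (exp (- z\<^sup>2) * z ^ k * 0)) at_top"
          by (intro tendsto_intros)
        then show ?thesis by simp
      qed simp
    qed
    have "norm (?d s z) \<le> 2" for s z
      using abs_sin_le_one[of "m * ln (s * z + 1)"] abs_sin_le_one[of "m * ln s + m * ln z"]
      unfolding real_norm_def by linarith
    then have "norm (indicator {0<..} z *\<^sub>R (exp (- z\<^sup>2) * z ^ k * ?d s z)) \<le>
        indicator {0<..} z *\<^sub>R (2 * (exp (- z\<^sup>2) * z ^ k))" for s z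
      using mult_left_mono[of "norm (?d s z)" 2 "exp (- z\<^sup>2) * z ^ k"]
      by (simp add: abs_mult mult_ac split: split_indicator)
    then show "\<forall>\<^sub>F s in at_top. AE z in lborel.
        norm (indicator {0<..} z *\<^sub>R (exp (- z\<^sup>2) * z ^ k * ?d s z)) \<le>
        indicator {0<..} z *\<^sub>R (2 * (exp (- z\<^sup>2) * z ^ k))"
      by simp
  qed measurable
  moreover have "(LINT z|lborel. indicator {0<..} z *\<^sub>R (exp (- z\<^sup>2) * z ^ k * ?d s z)) =
      (LINT z:{0<..}|lborel. exp (- z\<^sup>2) * z ^ k * sin (m * ln (s * z + 1))) -
      (sin (m * ln s) * (LINT z:{0<..}|lborel. exp (- z\<^sup>2) * z ^ k * cos (m * ln z)) +
       cos (m * ln s) * (LINT z:{0<..}|lborel. exp (- z\<^sup>2) * z ^ k * sin (m * ln z)))" for s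
  proof -
    note integrable = gaussian_bounded_set_integrable[where B = 1 and k = k]
    have 1: "set_integrable lborel {0<..} (\<lambda>z. exp (- z\<^sup>2) * z ^ k * sin (m * ln (s * z + 1)))"
      by (rule integrable) auto
    have 2: "set_integrable lborel {0<..} (\<lambda>z. sin (m * ln s) * (exp (- z\<^sup>2) * z ^ k * cos (m * ln z)))"
      by (intro set_integrable_mult_right integrable) auto
    have 3: "set_integrable lborel {0<..} (\<lambda>z. cos (m * ln s) * (exp (- z\<^sup>2) * z ^ k * sin (m * ln z)))"
      by (intro set_integrable_mult_right integrable) auto
    have "(LINT z|lborel. indicator {0<..} z *\<^sub>R (exp (- z\<^sup>2) * z ^ k * ?d s z)) =
      (LINT z:{0<..}|lborel. exp (- z\<^sup>2) * z ^ k * sin (m * ln (s * z + 1)) -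
        (sin (m * ln s) * (exp (- z\<^sup>2) * z ^ k * cos (m * ln z)) +
         cos (m * ln s) * (exp (- z\<^sup>2) * z ^ k * sin (m * ln z))))"
      unfolding set_lebesgue_integral_def by (simp add: sin_add algebra_simps)
    also have "\<dots> = (LINT z:{0<..}|lborel. exp (- z\<^sup>2) * z ^ k * sin (m * ln (s * z + 1))) -
       ((LINT z:{0<..}|lborel. sin (m * ln s) * (exp (- z\<^sup>2) * z ^ k * cos (m * ln z))) +
        (LINT z:{0<..}|lborel. cos (m * ln s) * (exp (- z\<^sup>2) * z ^ k * sin (m * ln z))))"
      by (simp only: set_integral_diff(2)[OF 1 set_integral_add(1)[OF 2 3]] set_integral_add(2)[OF 2 3])
    finally show ?thesis by simp
  qed
  ultimately show ?thesis by simp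
qed

text \<open>This normalisation serves twice: it preserves the constant part (q + p)/2 of the
  profile, and it makes the cosine moment equal to 1 at m = 0.\<close>

lemma gaussian_total_mass:
  "2 * ball_volume TYPE('n::finite) / pi powr (real CARD('n) / 2) *
   (LINT z:{0<..}|lborel. exp (- z\<^sup>2) * z ^ (CARD('n) + 1)) = 1"
proof -
  have "(LINT z:{0<..}|lborel. exp (- z\<^sup>2) * z ^ (CARD('n) + 1)) =
      pi powr (real CARD('n) / 2) / (2 * ball_volume TYPE('n))"
    unfolding ball_volume_eq using gaussian_half_line_moment[of "CARD('n)"] by simp
  then show ?thesis
    using ball_volume_pos[where 'n='n] by simp
qed

lemma heat_solution_profile_asymptotic:
  "((\<lambda>t. heat_solution (\<lambda>x :: real ^ 'n::finite. profile CARD('n) p q m (norm x)) 0 t -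
      ((q + p) / 2 + (q - p) / 2 *
        (sin (m * ln (2 * sqrt t)) * gauss_moment TYPE('n) cos m +
         cos (m * ln (2 * sqrt t)) * gauss_moment TYPE('n) sin m))) \<longlongrightarrow> 0) at_top"
proof -
  define K where "K = 2 * ball_volume TYPE('n) / pi powr (real CARD('n) / 2)"
  define I where "I g = (LINT z:{0<..}|lborel. exp (- z\<^sup>2) * z ^ (CARD('n) + 1) * g z)"
    for g :: "real \<Rightarrow> real"
  define D where "D s = I (\<lambda>z. sin (m * ln (s * z + 1))) -
    (sin (m * ln s) * I (\<lambda>z. cos (m * ln z)) + cos (m * ln s) * I (\<lambda>z. sin (m * ln z)))" for s
  have mass: "K * (LINT z:{0<..}|lborel. exp (- z\<^sup>2) * z ^ (CARD('n) + 1)) = 1"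
    unfolding K_def by (rule gaussian_total_mass)
  have moment: "gauss_moment TYPE('n) g m = K * I (\<lambda>z. g (m * ln z))" for g
    by (simp only: gauss_moment_def K_def I_def)
  have "(D \<longlongrightarrow> 0) at_top"
    unfolding D_def I_def by (rule gaussian_sin_ln_asymptotic)
  moreover have "filterlim (\<lambda>t. 2 * sqrt t) at_top at_top"
    by real_asymp
  ultimately have "((\<lambda>t. D (2 * sqrt t)) \<longlongrightarrow> 0) at_top"
    by (rule filterlim_compose)
  then have lim: "((\<lambda>t. (q - p) / 2 * (K * D (2 * sqrt t))) \<longlongrightarrow> 0) at_top"
    by (intro tendsto_mult_right_zero)
  \<comment> \<open>For t > 0 the deviation from the sinusoid is exactly a constant multiple of
    \<open>D\<close> at 2 sqrt t, whose limit is already known.\<close>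
  show ?thesis
  proof (rule Lim_transform_eventually[OF lim])
    show "\<forall>\<^sub>F t in at_top. (q - p) / 2 * (K * D (2 * sqrt t)) =
      heat_solution (\<lambda>x :: real ^ 'n. profile CARD('n) p q m (norm x)) 0 t -
      ((q + p) / 2 + (q - p) / 2 *
        (sin (m * ln (2 * sqrt t)) * gauss_moment TYPE('n) cos m +
         cos (m * ln (2 * sqrt t)) * gauss_moment TYPE('n) sin m))"
      using eventually_gt_at_top[of 0]
    proof eventually_elim
      case (elim t)
      define s where "s = 2 * sqrt t"
      define a c where "a = (q - p) / 2" and "c = (q + p) / 2"
      have 1: "set_integrable lborel {0<..} (\<lambda>z. c * (exp (- z\<^sup>2) * z ^ (CARD('n) + 1)))"
        by (intro set_integrable_mult_right gaussian_set_integrable)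
      have 2: "set_integrable lborel {0<..}
          (\<lambda>z. a * (exp (- z\<^sup>2) * z ^ (CARD('n) + 1) * sin (m * ln (s * z + 1))))"
        by (intro set_integrable_mult_right gaussian_bounded_set_integrable[where B = 1]) auto
      have "I (\<lambda>z. mean_profile p q m (s * z)) =
        (LINT z:{0<..}|lborel. c * (exp (- z\<^sup>2) * z ^ (CARD('n) + 1)) +
          a * (exp (- z\<^sup>2) * z ^ (CARD('n) + 1) * sin (m * ln (s * z + 1))))"
        unfolding I_def mean_profile_def a_def[symmetric] c_def[symmetric]
        by (simp only: distrib_left mult_ac)
      also have "\<dots> = c * (LINT z:{0<..}|lborel. exp (- z\<^sup>2) * z ^ (CARD('n) + 1)) +
          a * I (\<lambda>z. sin (m * ln (s * z + 1)))"
        by (simp only: set_integral_add(2)[OF 1 2] set_integral_mult_right I_def)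
      finally have "heat_solution (\<lambda>x :: real ^ 'n. profile CARD('n) p q m (norm x)) 0 t =
          K * (c * (LINT z:{0<..}|lborel. exp (- z\<^sup>2) * z ^ (CARD('n) + 1)) +
          a * I (\<lambda>z. sin (m * ln (s * z + 1))))"
        unfolding heat_solution_profile[OF elim] K_def[symmetric] I_def s_def by (simp only:)
      \<comment> \<open>Attaching \<open>K\<close> to each integral lets \<open>mass\<close> reduce
        the first term to c and \<open>moment\<close> recognise the others.\<close>
      also have "\<dots> = c * (K * (LINT z:{0<..}|lborel. exp (- z\<^sup>2) * z ^ (CARD('n) + 1))) +
          a * (K * I (\<lambda>z. sin (m * ln (s * z + 1))))"
        by (simp only: distrib_left mult_ac)
      finally show ?case
        unfolding mass moment D_def s_def[symmetric] a_def[symmetric] c_def[symmetric]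
        by (simp add: algebra_simps)
    qed
  qed
qed

section \<open>Existence of the frequency m\<close>

lemma continuous_on_gauss_moment:
  assumes g: "continuous_on UNIV g" "\<And>x. \<bar>g x\<bar> \<le> 1"
  shows "continuous_on UNIV (gauss_moment TYPE('n::finite) g)"
proof -
  have [measurable]: "g \<in> borel_measurable borel"
    by (rule borel_measurable_continuous_onI[OF g(1)])
  have "continuous_on UNIV
    (\<lambda>m. LINT z:{0<..}|lborel. exp (- z\<^sup>2) * z ^ (CARD('n) + 1) * g (m * ln z))"
    unfolding continuous_on_sequentially comp_def set_lebesgue_integral_def
  proof (intro allI ballI impI, elim conjE)
    fix X :: "nat \<Rightarrow> real" and a assume X: "X \<longlonglongrightarrow> a"
    show "(\<lambda>i. LINT z|lborel. indicator {0<..} z *\<^sub>R (exp (- z\<^sup>2) * z ^ (CARD('n) + 1) * g (X i * ln z))) \<longlonglongrightarrow>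
      (LINT z|lborel. indicator {0<..} z *\<^sub>R (exp (- z\<^sup>2) * z ^ (CARD('n) + 1) * g (a * ln z)))"
    \<comment> \<open>Since |g| \<le> 1, the Gaussian weight dominates the integrands for all
      frequencies at once.\<close>
    proof (rule integral_dominated_convergence)
      show "integrable lborel (\<lambda>z::real. indicator {0<..} z *\<^sub>R (exp (- z\<^sup>2) * z ^ (CARD('n) + 1)))"
        using gaussian_set_integrable[of "CARD('n) + 1"] by (simp add: set_integrable_def)
      show "AE z in lborel. (\<lambda>i. indicator {0<..} z *\<^sub>R (exp (- z\<^sup>2) * z ^ (CARD('n) + 1) * g (X i * ln z))) \<longlonglongrightarrow>
          indicator {0<..} z *\<^sub>R (exp (- z\<^sup>2) * z ^ (CARD('n) + 1) * g (a * ln z))"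
        by (intro AE_I2 tendsto_intros continuous_on_tendsto_compose[OF g(1)] X) auto
      show "AE z in lborel. norm (indicator {0<..} z *\<^sub>R (exp (- z\<^sup>2) * z ^ (CARD('n) + 1) * g (X i * ln z)))
          \<le> indicator {0<..} z *\<^sub>R (exp (- z\<^sup>2) * z ^ (CARD('n) + 1))" for i
        using mult_left_mono[OF g(2), of "exp (- z\<^sup>2) * z ^ (CARD('n) + 1)" for z :: real]
        by (intro AE_I2) (auto simp: abs_mult split: split_indicator)
    qed measurable
  qed
  then show ?thesis
    unfolding gauss_moment_def by (rule continuous_on_mult_left)
qed

text \<open>Integration by parts gains the factor 1/m: sin(m ln z + \<delta>)/z has an
  antiderivative of size at most 1/m. The weight z needed to restore the sine is the one supplied by
  the term z h'(z) in \<open>gaussian_by_parts\<close>.\<close>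

lemma gaussian_oscillatory_bound:
  fixes m \<delta> :: real
  assumes m: "0 < m"
  shows "\<bar>LINT z:{0<..}|lborel. exp (- z\<^sup>2) * z ^ k * sin (m * ln z + \<delta>)\<bar> \<le>
    (2 * (LINT z:{0<..}|lborel. exp (- z\<^sup>2) * z ^ (k + 2)) +
     real (Suc k) * (LINT z:{0<..}|lborel. exp (- z\<^sup>2) * z ^ k)) / m"
proof -
  define h where "h z = - cos (m * ln z + \<delta>) / m" for z
  have [measurable]: "h \<in> borel_measurable borel"
    unfolding h_def by measurable
  have h: "\<bar>h z\<bar> \<le> 1 / m" for z
    using m by (simp add: h_def divide_right_mono)
  have 1: "set_integrable lborel {0<..} (\<lambda>z. real (Suc k) * (exp (- z\<^sup>2) * z ^ k * h z))"
    by (intro set_integrable_mult_right gaussian_bounded_set_integrable[OF _ h]) auto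
  have 2: "set_integrable lborel {0<..} (\<lambda>z. exp (- z\<^sup>2) * z ^ k * sin (m * ln z + \<delta>))"
    by (rule gaussian_bounded_set_integrable[where B = 1]) auto
  have "2 * (LINT z:{0<..}|lborel. exp (- z\<^sup>2) * z ^ (k + 2) * h z) =
    (LINT z:{0<..}|lborel. exp (- z\<^sup>2) * z ^ k * (real (Suc k) * h z + z * (sin (m * ln z + \<delta>) / z)))"
  proof (rule gaussian_by_parts[symmetric, where B = "1 / m" and B' = 1])
    fix z :: real assume z: "0 < z"
    show "(h has_real_derivative sin (m * ln z + \<delta>) / z) (at z)"
      unfolding h_def using z m by (auto intro!: derivative_eq_intros)
    show "isCont (\<lambda>z. sin (m * ln z + \<delta>) / z) z"
      using z by (intro continuous_intros) auto
  qed (use h in auto)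
  also have "\<dots> = (LINT z:{0<..}|lborel. real (Suc k) * (exp (- z\<^sup>2) * z ^ k * h z) +
      exp (- z\<^sup>2) * z ^ k * sin (m * ln z + \<delta>))"
    by (rule set_lebesgue_integral_cong) (auto simp: algebra_simps)
  also have "\<dots> = real (Suc k) * (LINT z:{0<..}|lborel. exp (- z\<^sup>2) * z ^ k * h z) +
      (LINT z:{0<..}|lborel. exp (- z\<^sup>2) * z ^ k * sin (m * ln z + \<delta>))"
    by (simp only: set_integral_add(2)[OF 1 2] set_integral_mult_right)
  finally have eq: "(LINT z:{0<..}|lborel. exp (- z\<^sup>2) * z ^ k * sin (m * ln z + \<delta>)) =
      2 * (LINT z:{0<..}|lborel. exp (- z\<^sup>2) * z ^ (k + 2) * h z) -
      real (Suc k) * (LINT z:{0<..}|lborel. exp (- z\<^sup>2) * z ^ k * h z)"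
    by simp
  have "\<bar>LINT z:{0<..}|lborel. exp (- z\<^sup>2) * z ^ k * sin (m * ln z + \<delta>)\<bar> \<le> 2 * \<bar>LINT z:{0<..}|lborel. exp (- z\<^sup>2) * z ^ (k + 2) * h z\<bar> +
      real (Suc k) * \<bar>LINT z:{0<..}|lborel. exp (- z\<^sup>2) * z ^ k * h z\<bar>"
    unfolding eq by (rule order_trans[OF abs_triangle_ineq4]) (simp add: abs_mult)
  also have "\<dots> \<le> 2 * (1 / m * (LINT z:{0<..}|lborel. exp (- z\<^sup>2) * z ^ (k + 2))) +
      real (Suc k) * (1 / m * (LINT z:{0<..}|lborel. exp (- z\<^sup>2) * z ^ k))"
    by (intro add_mono mult_left_mono gaussian_integral_bound h) auto
  also have "\<dots> = (2 * (LINT z:{0<..}|lborel. exp (- z\<^sup>2) * z ^ (k + 2)) +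
     real (Suc k) * (LINT z:{0<..}|lborel. exp (- z\<^sup>2) * z ^ k)) / m"
    by (simp add: add_divide_distrib)
  finally show ?thesis .
qed

text \<open>The free shift treats both moments together: \<delta> = 0 gives the sine and \<delta> =
  pi/2 the cosine.\<close>

lemma gauss_moment_tendsto_0:
  assumes g: "\<And>x. g x = sin (x + \<delta>)"
  shows "(gauss_moment TYPE('n::finite) g \<longlongrightarrow> 0) at_top"
proof -
  let ?k = "CARD('n) + 1"
  let ?K = "2 * ball_volume TYPE('n) / pi powr (real CARD('n) / 2)"
  define D where "D = 2 * (LINT z:{0<..}|lborel. exp (- z\<^sup>2) * z ^ (?k + 2)) +
    real (Suc ?k) * (LINT z:{0<..}|lborel. exp (- z\<^sup>2) * z ^ ?k)"
  have "((\<lambda>m. LINT z:{0<..}|lborel. exp (- z\<^sup>2) * z ^ ?k * g (m * ln z)) \<longlongrightarrow> 0) at_top"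
  proof (rule Lim_null_comparison)
    show "\<forall>\<^sub>F m in at_top. norm (LINT z:{0<..}|lborel. exp (- z\<^sup>2) * z ^ ?k * g (m * ln z)) \<le> D / m"
      using eventually_gt_at_top[of 0]
      unfolding g D_def real_norm_def by eventually_elim (rule gaussian_oscillatory_bound)
    show "((\<lambda>m. D / m) \<longlongrightarrow> 0) at_top"
      by real_asymp
  qed
  then show ?thesis
    unfolding gauss_moment_def by (rule tendsto_mult_right_zero)
qed

text \<open>Intermediate value theorem for the squared modulus, which is continuous, equals 1 at m =
  0 and tends to 0 at infinity.\<close>

lemma exists_gauss_moment_modulus:
  assumes y: "0 < y" "y < 1"
  shows "\<exists>m>0. (gauss_moment TYPE('n::finite) cos m)\<^sup>2 + (gauss_moment TYPE('n) sin m)\<^sup>2 = y"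
proof -
  define G where "G m = (gauss_moment TYPE('n) cos m)\<^sup>2 + (gauss_moment TYPE('n) sin m)\<^sup>2" for m
  have "gauss_moment TYPE('n) cos 0 = 1"
    using gaussian_total_mass[where 'n='n]
    unfolding gauss_moment_def by (simp only: mult_zero_left cos_zero mult_1_right)
  moreover have "gauss_moment TYPE('n) sin 0 = 0"
    by (simp add: gauss_moment_def)
  ultimately have G0: "G 0 = 1"
    by (simp add: G_def)
  have cont: "continuous_on UNIV G"
    unfolding G_def by (intro continuous_intros continuous_on_gauss_moment) auto
  have "(gauss_moment TYPE('n) cos \<longlongrightarrow> 0) at_top" "(gauss_moment TYPE('n) sin \<longlongrightarrow> 0) at_top"
    by (rule gauss_moment_tendsto_0[where \<delta> = "pi / 2"], simp add: sin_add)
       (rule gauss_moment_tendsto_0[where \<delta> = 0], simp)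
  then have "(G \<longlongrightarrow> 0\<^sup>2 + 0\<^sup>2) at_top"
    unfolding G_def by (intro tendsto_intros)
  then have "(G \<longlongrightarrow> 0) at_top" by simp
  then have "\<forall>\<^sub>F m in at_top. G m < y"
    using y(1) by (rule order_tendstoD)
  then have "\<forall>\<^sub>F m in at_top. G m < y \<and> 0 < m"
    using eventually_gt_at_top[of 0] by (rule eventually_conj)
  then obtain M where M: "G M < y" "0 < M"
    by (auto simp: eventually_at_top_linorder)
  then obtain m where m: "0 \<le> m" "G m = y"
    using IVT2'[of G M y 0] y(2) G0 continuous_on_subset[OF cont] by auto
  \<comment> \<open>The value at m = 0 is 1, above y, so the intermediate point is not 0.\<close>
  then have "0 < m" using G0 y(2) by (cases "m = 0") auto
  with m show ?thesis unfolding G_def by blast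
qed

section \<open>Regularity and oscillation of the profile; conclusion\<close>

lemma continuous_on_profile_norm:
  "continuous_on UNIV (\<lambda>x :: real ^ 'n::finite. profile CARD('n) p q m (norm x))"
proof -
  have "norm x + 1 \<noteq> 0" for x :: "real ^ 'n"
    using norm_ge_zero[of x] by linarith
  then show ?thesis
    unfolding profile_def by (intro continuous_intros) auto
qed

lemma bounded_profile_norm:
  "bounded (range (\<lambda>x :: real ^ 'n::finite. profile CARD('n) p q m (norm x)))"
  by (rule boundedI[of _ "\<bar>(q + p) / 2\<bar> + \<bar>(q - p) / 2\<bar> + \<bar>(q - p) / 2 * m\<bar>"])
     (use abs_profile_le[of "CARD('n)"] in auto)

lemma oscillates_between_profile:
  fixes p \<alpha> \<beta> q :: real
  assumes ord: "p < \<alpha>" "\<alpha> < \<beta>" "\<beta> < q" and sum: "p + q = \<alpha> + \<beta>" and m: "0 < m"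
    and modulus: "(gauss_moment TYPE('n::finite) cos m)\<^sup>2 + (gauss_moment TYPE('n) sin m)\<^sup>2 =
      ((\<beta> - \<alpha>) / (q - p))\<^sup>2"
  shows "oscillates_between (\<lambda>x :: real ^ 'n. profile CARD('n) p q m (norm x)) p \<alpha> \<beta> q"
proof -
  let ?\<phi> = "\<lambda>x :: real ^ 'n. profile CARD('n) p q m (norm x)"
  \<comment> \<open>\<open>R\<close> is the modulus of the complex Gaussian moment. Dividing by it
    gives a point of the unit circle, whose angle \<delta> is the phase shift of the heat solution
    relative to the ball average.\<close>
  define R where "R = (\<beta> - \<alpha>) / (q - p)"
  have R: "0 < R" using ord by (simp add: R_def)
  have "(gauss_moment TYPE('n) cos m / R)\<^sup>2 + (gauss_moment TYPE('n) sin m / R)\<^sup>2 = 1"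
    using modulus R by (simp add: power_divide R_def[symmetric] flip: add_divide_distrib)
  then obtain \<delta> where \<delta>: "gauss_moment TYPE('n) cos m / R = cos \<delta>" "gauss_moment TYPE('n) sin m / R = sin \<delta>"
    by (rule sincos_total_2pi)
  then have moments: "gauss_moment TYPE('n) cos m = R * cos \<delta>" "gauss_moment TYPE('n) sin m = R * sin \<delta>"
    using R by (simp_all add: field_simps)
  have aR: "(q - p) / 2 * R = (\<beta> - \<alpha>) / 2"
  proof -
    have "d \<noteq> 0 \<Longrightarrow> d / 2 * (b / d) = b / 2" for b d :: real by simp
    then show ?thesis using ord by (simp only: R_def)
  qed
  have "(q - p) / 2 * (sin \<theta> * (R * cos \<delta>) + cos \<theta> * (R * sin \<delta>)) = (\<beta> - \<alpha>) / 2 * sin (\<theta> + \<delta>)" for \<theta>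
  proof -
    have "a * (S * (R * C') + C * (R * S')) = a * R * (S * C' + C * S')" for a S C S' C' :: real
      by (simp add: algebra_simps)
    then show ?thesis
      unfolding sin_add aR[symmetric] .
  qed
  then have heat: "((\<lambda>t. heat_solution ?\<phi> 0 t -
      ((q + p) / 2 + (\<beta> - \<alpha>) / 2 * sin (m * ln (2 * sqrt t) + \<delta>))) \<longlongrightarrow> 0) at_top"
    using heat_solution_profile_asymptotic[where 'n='n, of p q m] unfolding moments by simp
  \<comment> \<open>For \<tau> > 0 the average is exactly this sinusoid, so the difference is
    eventually zero.\<close>
  have avg: "((\<lambda>\<tau>. ball_average ?\<phi> \<tau> - ((q + p) / 2 + (q - p) / 2 * sin (m * ln (\<tau> + 1) + 0))) \<longlongrightarrow> 0) at_top"
    by (rule tendsto_eventually)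
       (use eventually_gt_at_top[of 0] in eventually_elim, simp add: ball_average_profile mean_profile_def)
  \<comment> \<open>Solving m ln(2 sqrt t) = y for t gives this inverse phase; for the average, m
    ln(\<tau> + 1) = y gives exp(y/m) - 1.\<close>
  have \<psi>_heat: "filterlim (\<lambda>y. exp (2 * y / m) / 4) at_top at_top"
    using m by real_asymp
  have \<theta>_heat: "m * ln (2 * sqrt (exp (2 * y / m) / 4)) = y" for y
  proof -
    have "exp (2 * y / m) / 4 = (exp (y / m) / 2)\<^sup>2"
      by (simp add: power_divide flip: exp_double)
    then show ?thesis using m by (simp add: real_sqrt_unique)
  qed
  have \<psi>_avg: "filterlim (\<lambda>y. exp (y / m) - 1) at_top at_top"
    using m by real_asymp
  have \<theta>_avg: "m * ln (exp (y / m) - 1 + 1) = y" for y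
    using m by simp
  have nonneg: "0 \<le> (\<beta> - \<alpha>) / 2" "0 \<le> (q - p) / 2"
    using ord by auto
  \<comment> \<open>The hypothesis p + q = \<alpha> + \<beta> says that both oscillations have the
    same centre, so the extremes of the heat solution are exactly \<alpha> and \<beta>.\<close>
  have eqs: "(q + p) / 2 + (q - p) / 2 = q" "(q + p) / 2 - (q - p) / 2 = p"
    "(q + p) / 2 + (\<beta> - \<alpha>) / 2 = \<beta>" "(q + p) / 2 - (\<beta> - \<alpha>) / 2 = \<alpha>"
    using sum by (simp_all add: field_simps)
  show ?thesis
    unfolding oscillates_between_def
    using ord
      Limsup_sin_phase[OF avg nonneg(2) \<psi>_avg \<theta>_avg] Liminf_sin_phase[OF avg nonneg(2) \<psi>_avg \<theta>_avg]
      Limsup_sin_phase[OF heat nonneg(1) \<psi>_heat \<theta>_heat] Liminf_sin_phase[OF heat nonneg(1) \<psi>_heat \<theta>_heat]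
    unfolding eqs by blast
qed

theorem theorem5:
  fixes p \<alpha> \<beta> q :: real
  assumes "p < \<alpha>" and "\<alpha> < \<beta>" and "\<beta> < q" and "p + q = \<alpha> + \<beta>"
  shows
    "(\<exists>\<phi> :: real ^ 'n::finite \<Rightarrow> real.
        continuous_on UNIV \<phi> \<and> bounded (range \<phi>) \<and> radial \<phi> \<and>
        oscillates_between \<phi> p \<alpha> \<beta> q) \<and>
     ((\<beta> - \<alpha>) / (q - p))\<^sup>2 \<in> {0<..<1} \<and>
     (\<exists>m>0. (gauss_moment TYPE('n) cos m)\<^sup>2 + (gauss_moment TYPE('n) sin m)\<^sup>2
             = ((\<beta> - \<alpha>) / (q - p))\<^sup>2) \<and>
     (\<forall>m>0. (gauss_moment TYPE('n) cos m)\<^sup>2 + (gauss_moment TYPE('n) sin m)\<^sup>2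
             = ((\<beta> - \<alpha>) / (q - p))\<^sup>2 \<longrightarrow>
        (let \<phi> = (\<lambda>x :: real ^ 'n. profile CARD('n) p q m (norm x)) in
           continuous_on UNIV \<phi> \<and> bounded (range \<phi>) \<and> radial \<phi> \<and>
           oscillates_between \<phi> p \<alpha> \<beta> q))"
proof -
  \<comment> \<open>The interval [\<alpha>, \<beta>] lies strictly inside [p, q], so the ratio of
    the lengths is below 1.\<close>
  have "0 < (\<beta> - \<alpha>) / (q - p)" "(\<beta> - \<alpha>) / (q - p) < 1"
    using assms by auto
  then have y: "0 < ((\<beta> - \<alpha>) / (q - p))\<^sup>2" "((\<beta> - \<alpha>) / (q - p))\<^sup>2 < 1"
    by (simp_all only: zero_less_power abs_square_less_1 abs_of_pos)
  \<comment> \<open>Proved for every admissible m; the existence of \<phi> then follows from the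
    existence of one such m.\<close>
  have good: "continuous_on UNIV \<phi> \<and> bounded (range \<phi>) \<and> radial \<phi> \<and> oscillates_between \<phi> p \<alpha> \<beta> q"
    if "0 < m" "(gauss_moment TYPE('n) cos m)\<^sup>2 + (gauss_moment TYPE('n) sin m)\<^sup>2 = ((\<beta> - \<alpha>) / (q - p))\<^sup>2"
      "\<phi> = (\<lambda>x :: real ^ 'n. profile CARD('n) p q m (norm x))" for m \<phi>
    unfolding that(3)
    using continuous_on_profile_norm bounded_profile_norm oscillates_between_profile[OF assms that(1,2)]
    by (auto simp: radial_def)
  obtain m where "0 < m"
    "(gauss_moment TYPE('n) cos m)\<^sup>2 + (gauss_moment TYPE('n) sin m)\<^sup>2 = ((\<beta> - \<alpha>) / (q - p))\<^sup>2"
    using exists_gauss_moment_modulus[OF y, where 'n='n] by blast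
  with good y show ?thesis
    unfolding Let_def by (meson greaterThanLessThan_iff)
qed

end
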